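(* Let $p$ and $q$ be primes with $q \equiv 1 \pmod p$. Let $x$ be a generator of the multiplicative group of non-zero elements of $\mathbb{Z}_q$, and let $\phi : \mathbb{Z}_q \to \{0\} \cup \langle \zeta_p \rangle$ be the map defined by $\phi(0) = 0$ and $\phi(x^j) = \zeta_p^j$ for $1 \le j \le q-1$. Let $C = \mathrm{circ}([\phi(0),\phi(1),\ldots,\phi(q-1)])$. Then the $(q+1)\times(q+1)$ matrix \[ W = \left[\begin{array}{c|c} 0 & \mathbf{1} \\ \hline \mathbf{1}^{\top} & C \end{array}\right], \] where $\mathbf{1}$ is the all-ones row vector of length $q$, is a $\mathrm{CGW}(q+1,q;p)$.
   Context: For a positive integer $k$, let $\zeta_k = e^{2\pi\sqrt{-1}/k}$, $\langle \zeta_k\rangle = \{\zeta_k^j : 0 \le j \le k-1\}$, and $\mathcal{U}_k = \{0\} \cup \langle \zeta_k\rangle$. A $\mathrm{CGW}(n,w;k)$ (complex generalized weighing matrix of order $n$ and weight $w$) is an $n \times n$ matrix $W$ with entries in $\mathcal{U}_k$ such that $WW^{*} = wI_n$, where $W^*$ is the complex conjugate transpose. $\mathbb{Z}_q$ is the ring of integers modulo $q$. The circulant matrix $\mathrm{circ}([c_0,\ldots,c_{n-1}])$ is the $n \times n$ matrix $[c_{j-i}]_{i,j \in \mathbb{Z}_n}$ (indices read modulo $n$). *)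

theory Defs
  imports
    "HOL-Analysis.Analysis"
    "HOL-Algebra.Generated_Groups"
    "HOL-Number_Theory.Residues"
    "Jordan_Normal_Form.Schur_Decomposition"
begin

definition zeta :: "nat \<Rightarrow> complex" where
  "zeta k = exp (2 * of_real pi * \<i> / of_nat k)"

definition zeta_powers :: "nat \<Rightarrow> complex set" where
  "zeta_powers k = {zeta k ^ j | j. j < k}"

definition U :: "nat \<Rightarrow> complex set" where
  "U k = {0} \<union> zeta_powers k"

(* The Hermitian transpose is mat_adjoint, which conjugates entries. *)
definition CGW :: "nat \<Rightarrow> nat \<Rightarrow> nat \<Rightarrow> complex mat \<Rightarrow> bool" where
  "CGW n w k W \<longleftrightarrow>
     k > 0 \<and> W \<in> carrier_mat n n \<and> elements_mat W \<subseteq> U k \<and>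
     W * mat_adjoint W = of_nat w \<cdot>\<^sub>m 1\<^sub>m n"

(* Row i, column j holds c ! (j - i), with the difference taken in the integers
   and then reduced modulo n, since subtraction on nat truncates. *)
definition circ :: "'a list \<Rightarrow> 'a mat" where
  "circ c = (let n = length c in
     mat n n (\<lambda>(i, j). c ! nat ((int j - int i) mod int n)))"

definition ones_row :: "nat \<Rightarrow> complex mat" where
  "ones_row n = mat 1 n (\<lambda>_. 1)"

end

theory Submission
  imports Defs
begin

text \<open>The map \<open>\<phi>\<close> is a nontrivial multiplicative character of \<open>\<int>\<^sub>q\<close>, so its values sum to zero.
  Its autocorrelation \<open>T d = (\<Sum>u. \<phi> u * cnj (\<phi> (u + d)))\<close> does not change when \<open>d\<close> is multiplied
  by a unit, since \<open>\<bar>\<phi>\<bar> = 1\<close> on units; hence \<open>T d = T 1\<close> for \<open>d \<noteq> 0\<close>. As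
  \<open>(\<Sum>d. T d) = \<bar>\<Sum>u. \<phi> u\<bar>\<^sup>2 = 0\<close> and \<open>T 0 = q - 1\<close>, it follows that \<open>T d = -1\<close> for \<open>d \<noteq> 0\<close>.
  The border of ones corrects \<open>C C\<^sup>* = q I - J\<close> to \<open>q I\<close>, and the vanishing row sums of \<open>C\<close> make
  the border orthogonal to the remaining rows.\<close>

section \<open>Roots of unity and reindexing of sums modulo \<open>n\<close>\<close>

lemma zeta_power_eq_1: "k > 0 \<Longrightarrow> zeta k ^ k = 1"
  unfolding zeta_def using exp_of_nat_mult[of k "2 * of_real pi * \<i> / of_nat k", symmetric]
  by (simp add: exp_eq_1)

lemma norm_zeta [simp]: "norm (zeta k) = 1"
  using norm_exp_i_times[of "2 * pi / of_nat k"] by (simp add: zeta_def mult_ac)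

text \<open>Otherwise comparing arguments would make \<open>1 / k\<close> an integer.\<close>

lemma zeta_neq_1:
  assumes "k > 1"
  shows "zeta k \<noteq> 1"
proof
  assume "zeta k = 1"
  then obtain n :: int where "Im (2 * of_real pi * \<i> / of_nat k) = of_int (2 * n) * pi"
    unfolding zeta_def exp_eq_1 by blast
  hence "real_of_int (n * int k) = 1"
    using assms by (simp add: field_simps)
  hence "n * int k = 1" by linarith
  thus False using assms by (simp add: zmult_eq_1_iff)
qed

text \<open>An injection of the finite set of residues into itself is a permutation. This covers
  both substitutions used below: shifts and multiplication by units.\<close>

lemma sum_mod_reindex:
  fixes g :: "int \<Rightarrow> 'a::comm_monoid_add" and h :: "int \<Rightarrow> int" and n :: int
  assumes "n > 0" and periodic: "\<And>a. g (a mod n) = g a"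
    and inj: "\<And>a b. [h a = h b] (mod n) \<Longrightarrow> [a = b] (mod n)"
  shows "(\<Sum>a\<in>{0..<n}. g (h a)) = sum g {0..<n}"
proof -
  have "inj_on (\<lambda>a. h a mod n) {0..<n}"
  proof (rule inj_onI)
    fix a b assume "a \<in> {0..<n}" "b \<in> {0..<n}" "h a mod n = h b mod n"
    thus "a = b"
      using inj[of a b] by (simp add: cong_def)
  qed
  moreover have "(\<lambda>a. h a mod n) ` {0..<n} \<subseteq> {0..<n}"
    using \<open>n > 0\<close> by auto
  ultimately have "bij_betw (\<lambda>a. h a mod n) {0..<n} {0..<n}"
    by (simp add: bij_betw_def endo_inj_surj)
  from sum.reindex_bij_betw[OF this, of g] show ?thesis
    by (simp add: periodic)
qed

text \<open>Characters are taken as \<open>q\<close>-periodic functions on all of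
  \<open>int\<close>, so that index differences such as \<open>int k - int i\<close> can be
  arguments without prior reduction.\<close>

locale nontrivial_character =
  fixes q :: nat and \<psi> :: "int \<Rightarrow> complex"
  assumes prime_q: "prime q"
    and periodic: "\<psi> (a mod int q) = \<psi> a"
    and mult: "\<psi> (a * b) = \<psi> a * \<psi> b"
    and zero: "\<psi> 0 = 0"
    and norm_unit: "\<not> int q dvd a \<Longrightarrow> norm (\<psi> a) = 1"
    and nontrivial: "\<exists>a. \<not> int q dvd a \<and> \<psi> a \<noteq> 1"
begin

section \<open>Character sums and autocorrelation\<close>

lemma q_pos: "q > 0"
  using prime_q prime_gt_0_nat by blast

lemma periodic_add: "\<psi> (a mod int q + b) = \<psi> (a + b)"
  by (metis periodic mod_add_left_eq)

lemma sum_shift: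
  fixes g :: "int \<Rightarrow> complex"
  assumes "\<And>a. g (a mod int q) = g a"
  shows "(\<Sum>a\<in>{0..<int q}. g (a + c)) = sum g {0..<int q}"
  by (rule sum_mod_reindex) (use q_pos assms in \<open>auto simp: cong_add_rcancel\<close>)

lemma sum_scale:
  fixes g :: "int \<Rightarrow> complex"
  assumes "\<And>a. g (a mod int q) = g a" and "\<not> int q dvd d"
  shows "(\<Sum>a\<in>{0..<int q}. g (d * a)) = sum g {0..<int q}"
proof (rule sum_mod_reindex)
  have "coprime d (int q)"
    using assms(2) prime_q by (metis coprime_commute prime_imp_coprime_int prime_nat_int_transfer)
  thus "[a = b] (mod int q)" if "[d * a = d * b] (mod int q)" for a b
    using that by (simp add: cong_mult_lcancel)
qed (use q_pos assms in auto)

text \<open>Multiplication by a unit \<open>a\<close> with \<open>\<psi> a \<noteq> 1\<close>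
  permutes the summands, so the sum is unchanged by a factor other than 1.\<close>

lemma sum_eq_0: "sum \<psi> {0..<int q} = 0"
proof -
  obtain a where a: "\<not> int q dvd a" "\<psi> a \<noteq> 1"
    using nontrivial by blast
  have "\<psi> a * sum \<psi> {0..<int q} = sum \<psi> {0..<int q}"
    using sum_scale[of \<psi>, OF periodic a(1)] by (simp add: mult sum_distrib_left)
  thus ?thesis using a(2) by simp
qed

definition autocorrelation :: "int \<Rightarrow> complex" where
  "autocorrelation d = (\<Sum>u\<in>{0..<int q}. \<psi> u * cnj (\<psi> (u + d)))"

lemma autocorrelation_0: "autocorrelation 0 = of_nat q - 1"
proof -
  have "autocorrelation 0 = (\<Sum>u\<in>{0..<int q}. of_bool (u \<noteq> 0))"
    unfolding autocorrelation_def
  proof (rule sum.cong[OF refl])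
    fix u assume "u \<in> {0..<int q}"
    hence "u \<noteq> 0 \<Longrightarrow> \<not> int q dvd u"
      using zdvd_not_zless[of u "int q"] by auto
    thus "\<psi> u * cnj (\<psi> (u + 0)) = of_bool (u \<noteq> 0)"
      using norm_unit[of u] zero by (auto simp: complex_norm_square[symmetric])
  qed
  also have "\<dots> = (\<Sum>u\<in>{0..<int q} - {0}. 1)"
    using q_pos by (intro sum.mono_neutral_cong_right) auto
  also have "\<dots> = of_nat q - 1"
    using q_pos by (simp add: of_nat_diff)
  finally show ?thesis .
qed

text \<open>Substituting \<open>d * u\<close> for \<open>u\<close> pulls out
  \<open>\<psi> d * cnj (\<psi> d)\<close>, the squared modulus of a unit value.\<close>

lemma autocorrelation_unit:
  assumes "\<not> int q dvd d"
  shows "autocorrelation d = autocorrelation 1"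
proof -
  have "autocorrelation d = (\<Sum>u\<in>{0..<int q}. \<psi> (d * u) * cnj (\<psi> (d * u + d)))"
    unfolding autocorrelation_def
    by (rule sum_scale[symmetric]) (use assms in \<open>auto simp: periodic periodic_add\<close>)
  also have "\<dots> = (\<Sum>u\<in>{0..<int q}. (\<psi> d * cnj (\<psi> d)) * (\<psi> u * cnj (\<psi> (u + 1))))"
  proof (rule sum.cong[OF refl])
    fix u
    have "d * u + d = d * (u + 1)" by (simp add: algebra_simps)
    thus "\<psi> (d * u) * cnj (\<psi> (d * u + d)) = (\<psi> d * cnj (\<psi> d)) * (\<psi> u * cnj (\<psi> (u + 1)))"
      by (simp add: mult)
  qed
  also have "\<psi> d * cnj (\<psi> d) = 1"
    using norm_unit[OF assms] by (simp add: complex_norm_square[symmetric])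
  finally show ?thesis
    by (simp add: autocorrelation_def)
qed

lemma sum_autocorrelation: "(\<Sum>d\<in>{0..<int q}. autocorrelation d) = 0"
proof -
  have "(\<Sum>d\<in>{0..<int q}. autocorrelation d)
      = (\<Sum>u\<in>{0..<int q}. \<psi> u * cnj (\<Sum>d\<in>{0..<int q}. \<psi> (d + u)))"
    unfolding autocorrelation_def by (subst sum.swap) (simp add: sum_distrib_left add.commute)
  also have "\<dots> = 0"
    by (simp only: sum_shift[of \<psi>, OF periodic] sum_eq_0) simp
  finally show ?thesis .
qed

lemma autocorrelation_eq:
  "autocorrelation d = (if int q dvd d then of_nat q - 1 else - 1)"
proof (cases "int q dvd d")
  case True
  hence "autocorrelation d = autocorrelation 0"
    unfolding autocorrelation_def
    by (intro sum.cong refl) (metis dvd_eq_mod_eq_0 mod_add_right_eq periodic)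
  thus ?thesis using True autocorrelation_0 by simp
next
  case False
  have "(\<Sum>e\<in>{0..<int q}. autocorrelation e)
      = autocorrelation 0 + (\<Sum>e\<in>{0..<int q} - {0}. autocorrelation e)"
    using q_pos by (intro sum.remove) auto
  also have "(\<Sum>e\<in>{0..<int q} - {0}. autocorrelation e) = (\<Sum>e\<in>{0..<int q} - {0}. autocorrelation 1)"
    using zdvd_not_zless[of _ "int q"] by (intro sum.cong refl autocorrelation_unit) auto
  finally have "0 = autocorrelation 0 + (\<Sum>e\<in>{0..<int q} - {0}. autocorrelation 1)"
    by (simp only: sum_autocorrelation)
  also have "\<dots> = (of_nat q - 1) * (1 + autocorrelation 1)"
    using q_pos by (simp add: autocorrelation_0 of_nat_diff algebra_simps)
  \<comment> \<open>The factor \<open>of_nat q - 1\<close> can be cancelled because a prime exceeds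
    1.\<close>
  finally have "autocorrelation 1 = - 1"
    using prime_gt_1_nat[OF prime_q] by (auto simp: add_eq_0_iff)
  thus ?thesis using False autocorrelation_unit[OF False] by simp
qed

lemma row_sum: "(\<Sum>k<q. \<psi> (int k - int i)) = 0"
proof -
  have "(\<Sum>k<q. \<psi> (int k - int i)) = (\<Sum>a\<in>{0..<int q}. \<psi> (a + - int i))"
    by (rule sum.reindex_bij_witness[of _ nat int]) auto
  thus ?thesis
    by (simp only: sum_shift[of \<psi>, OF periodic] sum_eq_0)
qed

lemma row_inner_product:
  assumes "i < q" "j < q"
  shows "(\<Sum>k<q. \<psi> (int k - int i) * cnj (\<psi> (int k - int j)))
    = (if i = j then of_nat q - 1 else - 1)" (is "?lhs = _")
proof -
  define g where "g a = \<psi> a * cnj (\<psi> (a + (int i - int j)))" for a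
  have "(\<Sum>k<q. \<psi> (int k - int i) * cnj (\<psi> (int k - int j)))
      = (\<Sum>a\<in>{0..<int q}. g (a + - int i))"
    unfolding g_def by (rule sum.reindex_bij_witness[of _ nat int]) auto
  also have "\<dots> = autocorrelation (int i - int j)"
    by (subst sum_shift) (auto simp: g_def periodic periodic_add autocorrelation_def)
  finally have "?lhs = autocorrelation (int i - int j)" .
  \<comment> \<open>Both indices lie below \<open>q\<close>, so congruence modulo \<open>q\<close>
    is equality.\<close>
  moreover have "int q dvd int i - int j \<longleftrightarrow> i = j"
    using assms cong_less_modulus_unique_nat[of i j q]
    by (auto simp flip: cong_iff_dvd_diff simp: cong_int_iff)
  ultimately show ?thesis
    by (simp add: autocorrelation_eq)
qed

end

text \<open>Discrete logarithms: in a finite group, natural exponents already exhaust the subgroup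
  generated by one element. The conclusion is phrased with integer powers so that later steps can
  stay in modular arithmetic.\<close>

lemma generator_residue_ring_power:
  fixes q :: nat and x a :: int
  defines "R \<equiv> residue_ring (int q)"
  assumes "prime q" and x: "x \<in> carrier (mult_of R)"
    and gen: "generate (mult_of R) {x} = carrier (mult_of R)"
    and a: "\<not> int q dvd a"
  obtains j :: nat where "a mod int q = x ^ j mod int q"
proof -
  interpret residues_prime q R
    by unfold_locales (use assms in auto)
  interpret M: group "mult_of R" by (rule field.field_mult_group[OF is_field])
  have "a mod int q \<in> generate (mult_of R) {x}"
    using a by (simp add: gen res_zero_eq dvd_eq_mod_eq_0)
  then obtain j :: nat where "a mod int q = x [^]\<^bsub>R\<^esub> j"
    using M.generate_pow_on_finite_carrier[OF _ x] by (auto simp: nat_pow_mult_of)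
  also have "x = x mod int q"
    using x by (auto simp: res_carrier_eq)
  finally show ?thesis
    using that by (simp add: pow_cong)
qed

section \<open>The bordered circulant matrix\<close>

lemma mat_adjoint_carrier: "A \<in> carrier_mat n m \<Longrightarrow> mat_adjoint A \<in> carrier_mat m n"
  by (auto simp: mat_adjoint_def)

lemma index_mult_mat_adjoint:
  fixes A :: "complex mat"
  assumes "A \<in> carrier_mat n m" "i < n" "j < n"
  shows "(A * mat_adjoint A) $$ (i, j) = (\<Sum>k<m. A $$ (i, k) * cnj (A $$ (j, k)))"
  using assms
  by (auto simp: mat_adjoint_def scalar_prod_def mat_of_rows_index atLeast0LessThan intro!: sum.cong)

lemma one_in_U: "k > 0 \<Longrightarrow> 1 \<in> U k"
  unfolding U_def zeta_powers_def by (auto intro!: exI[of _ 0])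

text \<open>The product with the adjoint depends only on the character axioms; roots of unity enter
  through \<open>values_U\<close>.\<close>

lemma (in nontrivial_character) CGW_bordered_circ:
  assumes "p > 0" and values_U: "\<And>a. \<psi> a \<in> U p" and length: "length c = q"
    and nth: "\<And>k. k < q \<Longrightarrow> c ! k = \<psi> (int k)"
  shows "CGW (q + 1) q p
    (four_block_mat (0\<^sub>m 1 1) (ones_row q) (transpose_mat (ones_row q)) (circ c))"
proof -
  define W where "W = four_block_mat (0\<^sub>m 1 1) (ones_row q) (transpose_mat (ones_row q)) (circ c)"
  have circ: "circ c \<in> carrier_mat q q"
    by (simp add: circ_def Let_def length)
  have W: "W \<in> carrier_mat (q + 1) (q + 1)"
    unfolding W_def using four_block_carrier_mat[of "0\<^sub>m 1 1" 1 1 "circ c" q q] circ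
    by (simp add: add.commute)
  have circ_index: "circ c $$ (i, j) = \<psi> (int j - int i)" if "i < q" "j < q" for i j
    using that nth[of "nat ((int j - int i) mod int q)"] q_pos
    by (simp add: circ_def Let_def length nat_less_iff periodic)
  have W00: "W $$ (0, 0) = 0"
    using circ by (simp add: W_def)
  have W0S: "W $$ (0, Suc j) = 1" if "j < q" for j
    using circ that by (simp add: W_def ones_row_def)
  have WS0: "W $$ (Suc i, 0) = 1" if "i < q" for i
    using circ that by (simp add: W_def ones_row_def)
  have WSS: "W $$ (Suc i, Suc j) = \<psi> (int j - int i)" if "i < q" "j < q" for i j
    using circ that circ_index by (simp add: W_def)
  have "elements_mat W \<subseteq> U p"
  proof
    fix a assume "a \<in> elements_mat W"
    then obtain i j where "i < Suc q" "j < Suc q" "a = W $$ (i, j)"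
      using W by auto
    thus "a \<in> U p"
      using values_U one_in_U[OF \<open>p > 0\<close>]
      by (cases i; cases j) (auto simp: W00 W0S WS0 WSS U_def)
  qed
  moreover have "W * mat_adjoint W = of_nat q \<cdot>\<^sub>m 1\<^sub>m (q + 1)"
  proof (rule eq_matI)
    fix i j assume "i < dim_row (of_nat q \<cdot>\<^sub>m 1\<^sub>m (q + 1) :: complex mat)"
      and "j < dim_col (of_nat q \<cdot>\<^sub>m 1\<^sub>m (q + 1) :: complex mat)"
    hence ij: "i < Suc q" "j < Suc q" by simp_all
    \<comment> \<open>The border row against itself counts \<open>q\<close> ones; against another
      row it gives a row sum of \<open>\<psi>\<close>, up to conjugation. Two other rows get 1 from
      the border column, which turns \<open>q - 1\<close> into \<open>q\<close> and
      \<open>- 1\<close> into 0.\<close>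
    have "(\<Sum>k<Suc q. W $$ (i, k) * cnj (W $$ (j, k))) = (if i = j then of_nat q else 0)"
    proof (cases i)
      case 0
      show ?thesis
      proof (cases j)
        case (Suc j')
        have "(\<Sum>k<q. cnj (\<psi> (int k - int j'))) = 0"
          using row_sum[of j'] by (simp flip: cnj_sum)
        thus ?thesis
          using 0 Suc ij by (simp add: sum.lessThan_Suc_shift W00 W0S WSS del: sum.lessThan_Suc)
      qed (use 0 in \<open>simp add: sum.lessThan_Suc_shift W00 W0S del: sum.lessThan_Suc\<close>)
    next
      case (Suc i')
      show ?thesis
      proof (cases j)
        case 0
        thus ?thesis
          using Suc ij row_sum[of i']
          by (simp add: sum.lessThan_Suc_shift W00 W0S WSS del: sum.lessThan_Suc)
      next
        case (Suc j')
        thus ?thesis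
          using \<open>i = Suc i'\<close> ij row_inner_product[of i' j']
          by (simp add: sum.lessThan_Suc_shift WS0 WSS del: sum.lessThan_Suc)
      qed
    qed
    thus "(W * mat_adjoint W) $$ (i, j) = (of_nat q \<cdot>\<^sub>m 1\<^sub>m (q + 1)) $$ (i, j)"
      using ij index_mult_mat_adjoint[OF W, of i j] by simp
  qed (use W mat_adjoint_carrier[OF W] in auto)
  ultimately show ?thesis
    using \<open>p > 0\<close> W by (simp add: CGW_def W_def)
qed

theorem theorem3p2:
  fixes p q :: nat and x :: int and \<phi> :: "int \<Rightarrow> complex"
  defines "Zq \<equiv> residue_ring (int q)"
  assumes "prime p" and "prime q" and "[q = 1] (mod p)"
    and "x \<in> carrier (mult_of Zq)"
    and "generate (mult_of Zq) {x} = carrier (mult_of Zq)"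
    and "\<phi> \<in> carrier Zq \<rightarrow> U p"
    and "\<phi> 0 = 0"
    and "\<And>j::nat. 1 \<le> j \<Longrightarrow> j \<le> q - 1 \<Longrightarrow> \<phi> (x [^]\<^bsub>Zq\<^esub> j) = zeta p ^ j"
  shows "CGW (q + 1) q p
           (four_block_mat (0\<^sub>m 1 1) (ones_row q)
              (transpose_mat (ones_row q)) (circ (map \<phi> [0..int q - 1])))"
proof -
  interpret R: residues_prime q Zq
    by unfold_locales (use assms in auto)
  have p: "p > 1" and q: "q > 1"
    using assms(2,3) prime_gt_1_nat by auto
  have x: "0 < x" "x < int q"
    using assms(5) by (auto simp: R.res_carrier_eq R.res_zero_eq)
  have x_unit: "\<not> int q dvd x"
    using x zdvd_not_zless by blast
  \<comment> \<open>The congruence \<open>[q = 1] (mod p)\<close> enters here: it makes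
    \<open>q - 1\<close> a period of the powers of \<open>zeta p\<close>, as Fermat's theorem does
    for the powers of \<open>x\<close> modulo \<open>q\<close>.\<close>
  obtain m where m: "q - 1 = p * m"
    using assms(4) q by (metis cong_to_1_nat dvd_def)
  have fermat: "[x ^ (q - 1) = 1] (mod int q)"
  proof -
    have "x = int (nat x)" using x by simp
    moreover from this have "\<not> q dvd nat x" using x_unit by (metis int_dvd_int_iff)
    ultimately show ?thesis
      using fermat_theorem[OF assms(3)] by (metis cong_int_iff of_nat_1 of_nat_power)
  qed
  have zeta_period: "zeta p ^ (q - 1) = 1"
    unfolding m power_mult using p by (simp add: zeta_power_eq_1)
  \<comment> \<open>The hypothesis on \<open>\<phi>\<close> covers exponents from 1 to
    \<open>q - 1\<close> only; the common period \<open>q - 1\<close> extends it to all naturals,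
    including 0.\<close>
  have \<phi>_power: "\<phi> (x ^ j mod int q) = zeta p ^ j" for j
  proof -
    \<comment> \<open>The representative of \<open>j\<close> in the range from 1 to
      \<open>q - 1\<close>: the class of 0 is represented by \<open>q - 1\<close>.\<close>
    define r where "r = (if j mod (q - 1) = 0 then q - 1 else j mod (q - 1))"
    have r: "1 \<le> r" "r \<le> q - 1"
      using q mod_less_divisor[of "q - 1" j] by (auto simp: r_def)
    have cong: "[r = j] (mod (q - 1))"
      by (auto simp: r_def cong_def)
    have period: "[x ^ (i + (q - 1) * n) = x ^ i] (mod int q)"
         "zeta p ^ (i + (q - 1) * n) = zeta p ^ i" for i n
      using cong_mult[OF cong_refl[of "x ^ i"] cong_pow[OF fermat, of n]] zeta_period
      by (simp_all add: power_add power_mult)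
    \<comment> \<open>Here \<open>i\<close> is the common remainder of \<open>r\<close> and
      \<open>j\<close> modulo \<open>q - 1\<close>.\<close>
    obtain i n n' where "r = i + (q - 1) * n" "j = i + (q - 1) * n'"
      using cong unfolding cong_def by (metis mod_mult_div_eq)
    hence "[x ^ r = x ^ j] (mod int q)" "zeta p ^ r = zeta p ^ j"
      using period by (auto simp: cong_def)
    moreover have "x [^]\<^bsub>Zq\<^esub> r = x ^ r mod int q"
      using R.pow_cong[of x r] x by simp
    ultimately show ?thesis
      using assms(9)[OF r] by (simp add: cong_def)
  qed
  have log: "\<exists>j. a mod int q = x ^ j mod int q" if "\<not> int q dvd a" for a
    using generator_residue_ring_power[of q x a] assms(3,5,6) that unfolding Zq_def by metis
  \<comment> \<open>\<open>\<phi>\<close> is specified on residues only; reducing the argument first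
    gives the periodic function that the locale expects.\<close>
  define \<psi> where "\<psi> a = \<phi> (a mod int q)" for a
  interpret nontrivial_character q \<psi>
  proof
    show "\<psi> (a * b) = \<psi> a * \<psi> b" for a b
    proof (cases "int q dvd a \<or> int q dvd b")
      case True
      thus ?thesis using assms(8) by (auto simp: \<psi>_def)
    next
      \<comment> \<open>For two units, multiplicativity is addition of discrete logarithms.\<close>
      case False
      then obtain i j where "a mod int q = x ^ i mod int q" "b mod int q = x ^ j mod int q"
        using log by meson
      moreover from this have "a * b mod int q = x ^ (i + j) mod int q"
        by (metis mod_mult_eq power_add)
      ultimately show ?thesis
        by (simp only: \<psi>_def \<phi>_power) (simp add: power_add)
    qed
    show "norm (\<psi> a) = 1" if "\<not> int q dvd a" for a
      using log[OF that] by (auto simp: \<psi>_def \<phi>_power norm_power)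
    \<comment> \<open>The witness is the generator \<open>x\<close>, whose value is
      \<open>zeta p\<close>.\<close>
    show "\<exists>a. \<not> int q dvd a \<and> \<psi> a \<noteq> 1"
      using x_unit \<phi>_power[of 1] zeta_neq_1[OF p] by (auto simp: \<psi>_def)
  qed (use assms(3,8) in \<open>auto simp: \<psi>_def\<close>)
  show ?thesis
  proof (rule CGW_bordered_circ)
    show "\<psi> a \<in> U p" for a
      using assms(7) by (auto simp: \<psi>_def)
    show "map \<phi> [0..int q - 1] ! k = \<psi> (int k)" if "k < q" for k
      using that by (simp add: \<psi>_def)
  qed (use p in auto)
qed

end
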